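(* Let $\{V_n\}_{n\ge 0}$ be a generalized Tribonacci sequence with parameters $r,s,t$, let $\{O_{v,n}\}_{n\ge 0}$ be the associated generalized Tribonacci octonions, and let $\alpha,\omega_1,\omega_2$ be the roots of $x^3-rx^2-sx-t=0$. Then for any integer $n\geq 0$, $$O_{v,n}=\frac{P\,\underline{\alpha}\,\alpha^{n}}{(\alpha-\omega_{1})(\alpha-\omega_{2})}-\frac{Q\,\underline{\omega_{1}}\,\omega_{1}^{n}}{(\alpha-\omega_{1})(\omega_{1}-\omega_{2})}+\frac{R\,\underline{\omega_{2}}\,\omega_{2}^{n}}{(\alpha-\omega_{2})(\omega_{1}-\omega_{2})},$$ where $P=V_{2}-(\omega_{1}+\omega_{2})V_{1}+\omega_{1}\omega_{2}V_{0}$, $Q=V_{2}-(\alpha+\omega_{2})V_{1}+\alpha\omega_{2}V_{0}$, $R=V_{2}-(\alpha+\omega_{1})V_{1}+\alpha\omega_{1}V_{0}$, and $\underline{\alpha}=\sum_{l=0}^{7}\alpha^{l}e_{l}$, $\underline{\omega_{1}}=\sum_{l=0}^{7}\omega_{1}^{l}e_{l}$, $\underline{\omega_{2}}=\sum_{l=0}^{7}\omega_{2}^{l}e_{l}$.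
   Context: Generalized Tribonacci sequence: $r,s,t$ are real numbers, $V_0,V_1,V_2$ are arbitrary integers, and $V_n=rV_{n-1}+sV_{n-2}+tV_{n-3}$ for $n\ge 3$. Standing assumption: $\Delta=\frac{r^{3}t}{27}-\frac{r^{2}s^{2}}{108}+\frac{rst}{6}-\frac{s^{3}}{27}+\frac{t^{2}}{4}>0$, so that $x^3-rx^2-sx-t=0$ has one real root $\alpha$ and two nonreal complex conjugate roots $\omega_1,\omega_2$ (in particular the roots are distinct). Octonions: $\mathbb{O}$ is the real octonion algebra, an $8$-dimensional real vector space with basis $e_0=\mathbf{1},e_1,\dots,e_7$. The $n$-th generalized Tribonacci octonion is $O_{v,n}=\sum_{l=0}^{7}V_{n+l}e_l=V_n+\sum_{l=1}^{7}V_{n+l}e_l$, $n\ge 0$. The identity, which involves the complex numbers $\omega_1,\omega_2$, is read in the complexification $\mathbb{O}\otimes_{\mathbb{R}}\mathbb{C}$ (the complex vector space with basis $e_0,\dots,e_7$), where complex scalars multiply coefficientwise. *)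

theory Defs
  imports "HOL-Analysis.Analysis"
begin

text \<open>
  Octonions with coefficients in \<open>'a\<close>: \<open>real octonion\<close> is the real octonion algebra and
  \<open>complex octonion\<close> is its complexification. The coordinates are indexed by the type \<open>8\<close>,
  whose elements are the residues \<open>0, \<dots>, 7\<close> modulo 8, so the basis element \<open>\<e> l\<close> below is
  meant for \<open>l \<le> 7\<close>. A separate type is needed because the library's product and unit on
  \<open>'a ^ 8\<close> are the componentwise ones.
\<close>

typedef 'a octonion = "UNIV :: ('a ^ 8) set"
  morphisms octonion_coeffs Octonion ..

setup_lifting type_definition_octonion

instantiation octonion :: (ab_group_add) ab_group_add
begin

lift_definition zero_octonion :: "'a octonion" is 0 .
lift_definition plus_octonion :: "'a octonion \<Rightarrow> 'a octonion \<Rightarrow> 'a octonion" is "(+)" .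
lift_definition minus_octonion :: "'a octonion \<Rightarrow> 'a octonion \<Rightarrow> 'a octonion" is "(-)" .
lift_definition uminus_octonion :: "'a octonion \<Rightarrow> 'a octonion" is uminus .

instance by standard (transfer; simp add: algebra_simps)+

end

lift_definition octonion_scale :: "'a::comm_ring_1 \<Rightarrow> 'a octonion \<Rightarrow> 'a octonion"  (infixr "*\<^sub>O" 75)
  is "(*s)" .

lift_definition octonion_basis :: "nat \<Rightarrow> 'a::comm_ring_1 octonion"  ("\<e>")
  is "\<lambda>l. axis (of_nat l) 1" .

text \<open>
  The product is that of the Cayley-Dickson double of the quaternions,
  \<open>(a, b) (c, d) = (a c - d\<^sup>* b, d a + b c\<^sup>*)\<close>, with \<open>e\<^sub>0, \<dots>, e\<^sub>7\<close> corresponding to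
  \<open>(1,0), (i,0), (j,0), (k,0), (0,1), (0,i), (0,j), (0,k)\<close>. Equivalently, the products of distinct
  imaginary units are given by the oriented triples 123, 145, 176, 246, 257, 347, 365.
\<close>

instantiation octonion :: (comm_ring_1) "{one, times}"
begin

lift_definition one_octonion :: "'a octonion" is "axis 0 1" .

lift_definition times_octonion :: "'a octonion \<Rightarrow> 'a octonion \<Rightarrow> 'a octonion" is
  "\<lambda>x y.
     axis 0 (x$0 * y$0 - x$1 * y$1 - x$2 * y$2 - x$3 * y$3
                       - x$4 * y$4 - x$5 * y$5 - x$6 * y$6 - x$7 * y$7)
   + axis 1 (x$0 * y$1 + x$1 * y$0 + (x$2 * y$3 - x$3 * y$2)
               + (x$4 * y$5 - x$5 * y$4) + (x$7 * y$6 - x$6 * y$7))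
   + axis 2 (x$0 * y$2 + x$2 * y$0 + (x$3 * y$1 - x$1 * y$3)
               + (x$4 * y$6 - x$6 * y$4) + (x$5 * y$7 - x$7 * y$5))
   + axis 3 (x$0 * y$3 + x$3 * y$0 + (x$1 * y$2 - x$2 * y$1)
               + (x$4 * y$7 - x$7 * y$4) + (x$6 * y$5 - x$5 * y$6))
   + axis 4 (x$0 * y$4 + x$4 * y$0 + (x$5 * y$1 - x$1 * y$5)
               + (x$6 * y$2 - x$2 * y$6) + (x$7 * y$3 - x$3 * y$7))
   + axis 5 (x$0 * y$5 + x$5 * y$0 + (x$1 * y$4 - x$4 * y$1)
               + (x$7 * y$2 - x$2 * y$7) + (x$3 * y$6 - x$6 * y$3))
   + axis 6 (x$0 * y$6 + x$6 * y$0 + (x$1 * y$7 - x$7 * y$1)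
               + (x$2 * y$4 - x$4 * y$2) + (x$5 * y$3 - x$3 * y$5))
   + axis 7 (x$0 * y$7 + x$7 * y$0 + (x$6 * y$1 - x$1 * y$6)
               + (x$2 * y$5 - x$5 * y$2) + (x$3 * y$4 - x$4 * y$3))" .

instance ..

end

lemma octonion_basis_0: "\<e> 0 = 1"
  by transfer simp

lemma vector_space_octonion: "vector_space ((*\<^sub>O) :: 'a::field \<Rightarrow> _)"
  by unfold_locales (transfer; simp add: vec_eq_iff algebra_simps)+

lift_definition octonion_complexify :: "real octonion \<Rightarrow> complex octonion"
  is "\<lambda>x. \<chi> i. complex_of_real (x $ i)" .

fun gen_tribonacci :: "real \<Rightarrow> real \<Rightarrow> real \<Rightarrow> int \<Rightarrow> int \<Rightarrow> int \<Rightarrow> nat \<Rightarrow> real" where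
  "gen_tribonacci r s t V0 V1 V2 0 = of_int V0"
| "gen_tribonacci r s t V0 V1 V2 (Suc 0) = of_int V1"
| "gen_tribonacci r s t V0 V1 V2 (Suc (Suc 0)) = of_int V2"
| "gen_tribonacci r s t V0 V1 V2 (Suc (Suc (Suc n))) =
     r * gen_tribonacci r s t V0 V1 V2 (Suc (Suc n))
   + s * gen_tribonacci r s t V0 V1 V2 (Suc n)
   + t * gen_tribonacci r s t V0 V1 V2 n"

definition tribonacci_octonion :: "(nat \<Rightarrow> real) \<Rightarrow> nat \<Rightarrow> real octonion" where
  "tribonacci_octonion V n = (\<Sum>l=0..7. V (n + l) *\<^sub>O \<e> l)"

definition octonion_powers :: "complex \<Rightarrow> complex octonion" where
  "octonion_powers z = (\<Sum>l=0..7. z ^ l *\<^sub>O \<e> l)"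

text \<open>\<open>-108\<close> times this quantity is the discriminant of \<open>x\<^sup>3 - r x\<^sup>2 - s x - t\<close>.\<close>

definition tribonacci_delta :: "real \<Rightarrow> real \<Rightarrow> real \<Rightarrow> real" where
  "tribonacci_delta r s t =
     r^3 * t / 27 - r^2 * s^2 / 108 + r * s * t / 6 - s^3 / 27 + t^2 / 4"

end

theory Submission
  imports Defs
begin

text \<open>
  A sequence obeying a linear recurrence of order three is fixed by its first three values. If
  \<open>a\<close>, \<open>b\<close>, \<open>c\<close> are distinct roots of the characteristic polynomial, the sequences \<open>a\<^sup>n\<close>, \<open>b\<^sup>n\<close>, \<open>c\<^sup>n\<close>
  all obey the recurrence, so it suffices to find the combination with the right initial values;
  this Vandermonde system has the solution in \<open>binet_third_order\<close>. Applied at the index \<open>n + l\<close>,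
  that formula is the coefficient of \<open>\<e> l\<close> in the claim, since \<open>z\<^sup>n\<^sup>+\<^sup>l = z\<^sup>n z\<^sup>l\<close> and \<open>z\<^sup>l\<close> is the
  coefficient of \<open>\<e> l\<close> in \<open>octonion_powers z\<close>.

  It remains to see that the three roots are distinct, so that the denominators do not vanish.
  They are given only through the set of zeros, which a priori could list a repeated root.
  But \<open>-108 \<Delta>\<close> is the discriminant, that is, the product of the squared differences of
  the roots counted with multiplicity (\<open>cubic_discriminant\<close>). As \<open>\<Delta> \<noteq> 0\<close>, there are three different
  zeros, and a three-element set \<open>{\<alpha>, \<omega>\<^sub>1, \<omega>\<^sub>2}\<close> has no repetition among its listed elements.
\<close>

text \<open>
  Dividing by \<open>x - a\<close> leaves \<open>x\<^sup>2 - (r - a) x + (a\<^sup>2 - r a - s)\<close>, whose roots the quadratic formula gives.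
  The factorisation records multiplicities, which the set of zeros forgets.
\<close>

lemma monic_cubic_factor:
  fixes a r s t :: complex
  assumes "a^3 - r * a^2 - s * a - t = 0"
  obtains b c where "\<And>x. x^3 - r * x^2 - s * x - t = (x - a) * (x - b) * (x - c)"
    and "r = a + b + c" and "s = - (a * b + a * c + b * c)" and "t = a * b * c"
proof -
  define d where "d = csqrt ((r - a)^2 - 4 * (a^2 - r * a - s))"
  define b where "b = ((r - a) + d) / 2"
  define c where "c = ((r - a) - d) / 2"
  have d2: "d^2 = (r - a)^2 - 4 * (a^2 - r * a - s)"
    by (simp add: d_def)
  have sum: "b + c = r - a"
    by (simp add: b_def c_def field_simps)
  have "4 * (b * c) = (r - a)^2 - d^2"
    by (simp add: b_def c_def power2_eq_square field_simps)
  hence "4 * (b * c) = 4 * (a^2 - r * a - s)"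
    unfolding d2 by simp
  hence prod: "b * c = a^2 - r * a - s"
    by (simp only: mult_cancel_left) simp
  have r: "r = a + b + c"
    using sum by algebra
  have s: "s = - (a * b + a * c + b * c)"
    using sum prod by algebra
  have t: "t = a * b * c"
    using assms prod by algebra
  have "x^3 - r * x^2 - s * x - t = (x - a) * (x - b) * (x - c)" for x
    unfolding r s t by algebra
  thus thesis
    using r s t that by blast
qed

lemma cubic_discriminant:
  fixes a b c :: complex and r s t :: real
  assumes "of_real r = a + b + c" and "of_real s = - (a * b + a * c + b * c)"
    and "of_real t = a * b * c"
  shows "of_real (- 108 * tribonacci_delta r s t) = ((a - b) * (a - c) * (b - c))^2"
proof -
  have "- 108 * tribonacci_delta r s t
      = r^2 * s^2 - 4 * r^3 * t - 18 * r * s * t + 4 * s^3 - 27 * t^2"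
    by (simp add: tribonacci_delta_def)
  hence "complex_of_real (- 108 * tribonacci_delta r s t)
      = of_real (r^2 * s^2 - 4 * r^3 * t - 18 * r * s * t + 4 * s^3 - 27 * t^2)"
    by (rule arg_cong)
  also have "\<dots> = of_real r ^ 2 * of_real s ^ 2 - 4 * of_real r ^ 3 * of_real t
      - 18 * of_real r * of_real s * of_real t + 4 * of_real s ^ 3 - 27 * of_real t ^ 2"
    by simp
  also have "\<dots> = ((a - b) * (a - c) * (b - c))^2"
    unfolding assms by algebra
  finally show ?thesis .
qed

lemma distinct_cubic_roots:
  fixes a b c :: complex and r s t :: real
  assumes delta: "tribonacci_delta r s t \<noteq> 0"
    and roots: "{x :: complex. x^3 - of_real r * x^2 - of_real s * x - of_real t = 0} = {a, b, c}"
  shows "a \<noteq> b" and "a \<noteq> c" and "b \<noteq> c"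
proof -
  have "a^3 - of_real r * a^2 - of_real s * a - of_real t = 0"
    using roots by blast
  then obtain b' c' where fact: "\<And>x. x^3 - of_real r * x^2 - of_real s * x - of_real t
        = (x - a) * (x - b') * (x - c')"
    and vieta: "of_real r = a + b' + c'" "of_real s = - (a * b' + a * c' + b' * c')"
      "of_real t = a * b' * c'"
    by (rule monic_cubic_factor) blast
  have "{a, b, c} = {a, b', c'}"
    unfolding roots[symmetric] fact by auto
  moreover have "((a - b') * (a - c') * (b' - c'))^2 \<noteq> 0"
    using delta unfolding cubic_discriminant[OF vieta, symmetric] of_real_eq_0_iff by simp
  hence "a \<noteq> b'" "a \<noteq> c'" "b' \<noteq> c'"
    by auto
  hence "card {a, b', c'} = 3"
    by simp
  ultimately have "card {a, b, c} = 3"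
    by simp
  thus "a \<noteq> b" "a \<noteq> c" "b \<noteq> c"
    by (auto simp: card_insert_if split: if_splits)
qed

lemma third_order_recurrence_unique:
  fixes f g :: "nat \<Rightarrow> 'a::semiring_0"
  assumes "\<And>n. f (n + 3) = r * f (n + 2) + s * f (n + 1) + t * f n"
    and "\<And>n. g (n + 3) = r * g (n + 2) + s * g (n + 1) + t * g n"
    and "f 0 = g 0" and "f 1 = g 1" and "f 2 = g 2"
  shows "f n = g n"
proof -
  have "f n = g n \<and> f (n + 1) = g (n + 1) \<and> f (n + 2) = g (n + 2)"
  proof (induction n)
    case 0
    show ?case using assms by (simp add: numeral_2_eq_2)
  next
    case (Suc n)
    hence "f (n + 3) = g (n + 3)"
      by (simp only: assms(1,2))
    thus ?case using Suc by (simp add: numeral_3_eq_3)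
  qed
  thus ?thesis by simp
qed

text \<open>
  The coefficient of \<open>a\<^sup>n\<close> comes from applying to the sequence the operator \<open>(E - b) (E - c)\<close>, where
  \<open>E\<close> is the shift. It annihilates \<open>b\<^sup>n\<close> and \<open>c\<^sup>n\<close>, multiplies \<open>a\<^sup>n\<close> by \<open>(a - b) (a - c)\<close>, and its
  value at index \<open>0\<close> is \<open>U 2 - (b + c) U 1 + b c U 0\<close>. The coefficients of
  \<open>b\<^sup>n\<close> and \<open>c\<^sup>n\<close> arise in the same way; the minus sign is that of \<open>(b - a) (b - c) = - (a - b) (b - c)\<close>.
\<close>

lemma binet_third_order:
  fixes U :: "nat \<Rightarrow> 'a::field"
  assumes rec: "\<And>n. U (n + 3) = r * U (n + 2) + s * U (n + 1) + t * U n"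
    and a: "a^3 - r * a^2 - s * a - t = 0"
    and b: "b^3 - r * b^2 - s * b - t = 0"
    and c: "c^3 - r * c^2 - s * c - t = 0"
    and dist: "a \<noteq> b" "a \<noteq> c" "b \<noteq> c"
  shows "U n = (U 2 - (b + c) * U 1 + b * c * U 0) / ((a - b) * (a - c)) * a^n
             - (U 2 - (a + c) * U 1 + a * c * U 0) / ((a - b) * (b - c)) * b^n
             + (U 2 - (a + b) * U 1 + a * b * U 0) / ((a - c) * (b - c)) * c^n"
proof -
  define A where "A = (U 2 - (b + c) * U 1 + b * c * U 0) / ((a - b) * (a - c))"
  define B where "B = (U 2 - (a + c) * U 1 + a * c * U 0) / ((a - b) * (b - c))"
  define C where "C = (U 2 - (a + b) * U 1 + a * b * U 0) / ((a - c) * (b - c))"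
  have A: "A * ((a - b) * (a - c)) = U 2 - (b + c) * U 1 + b * c * U 0"
    and B: "B * ((a - b) * (b - c)) = U 2 - (a + c) * U 1 + a * c * U 0"
    and C: "C * ((a - c) * (b - c)) = U 2 - (a + b) * U 1 + a * b * U 0"
    using dist by (simp_all add: A_def B_def C_def)
  have vandermonde: "(a - b) * (a - c) * (b - c) \<noteq> 0"
    using dist by simp
  have power_rec: "z^(n + 3) = r * z^(n + 2) + s * z^(n + 1) + t * z^n"
    if "z^3 - r * z^2 - s * z - t = 0" for z n
  proof -
    have "z^(n + 3) - (r * z^(n + 2) + s * z^(n + 1) + t * z^n)
        = z^n * (z^3 - r * z^2 - s * z - t)"
      by (simp add: power_add power2_eq_square algebra_simps)
    thus ?thesis
      by (simp add: that)
  qed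
  have "U n = A * a^n - B * b^n + C * c^n"
  proof (rule third_order_recurrence_unique[where r = r and s = s and t = t])
    show "A * a^(n + 3) - B * b^(n + 3) + C * c^(n + 3)
        = r * (A * a^(n + 2) - B * b^(n + 2) + C * c^(n + 2))
        + s * (A * a^(n + 1) - B * b^(n + 1) + C * c^(n + 1))
        + t * (A * a^n - B * b^n + C * c^n)" for n
      unfolding power_rec[OF a] power_rec[OF b] power_rec[OF c] by algebra
    \<comment> \<open>Multiplied by the Vandermonde determinant, the initial conditions become polynomial
      consequences of \<open>A\<close>, \<open>B\<close> and \<open>C\<close>.\<close>
    have "(a - b) * (a - c) * (b - c) * U 0 = (a - b) * (a - c) * (b - c) * (A - B + C)"
      using A B C by algebra
    thus "U 0 = A * a^0 - B * b^0 + C * c^0"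
      using vandermonde by simp
    have "(a - b) * (a - c) * (b - c) * U 1
        = (a - b) * (a - c) * (b - c) * (A * a - B * b + C * c)"
      using A B C by algebra
    thus "U 1 = A * a^1 - B * b^1 + C * c^1"
      using vandermonde by simp
    have "(a - b) * (a - c) * (b - c) * U 2
        = (a - b) * (a - c) * (b - c) * (A * a^2 - B * b^2 + C * c^2)"
      using A B C by algebra
    thus "U 2 = A * a^2 - B * b^2 + C * c^2"
      using vandermonde by simp
  qed (rule rec)
  thus ?thesis
    unfolding A_def B_def C_def .
qed

lemma gen_tribonacci_rec:
  "gen_tribonacci r s t V0 V1 V2 (n + 3) = r * gen_tribonacci r s t V0 V1 V2 (n + 2)
     + s * gen_tribonacci r s t V0 V1 V2 (n + 1) + t * gen_tribonacci r s t V0 V1 V2 n"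
  by (simp add: numeral_3_eq_3 numeral_2_eq_2)

lemma octonion_complexify_add:
  "octonion_complexify (x + y) = octonion_complexify x + octonion_complexify y"
  by transfer (simp add: vec_eq_iff)

lemma octonion_complexify_0: "octonion_complexify 0 = 0"
  by transfer (simp add: vec_eq_iff)

lemma octonion_complexify_sum:
  "octonion_complexify (\<Sum>i\<in>I. f i) = (\<Sum>i\<in>I. octonion_complexify (f i))"
  using sum_comp_morphism[OF octonion_complexify_0 octonion_complexify_add, of f I]
  by (simp add: comp_def)

lemma octonion_complexify_scale_basis:
  "octonion_complexify (x *\<^sub>O \<e> l) = of_real x *\<^sub>O \<e> l"
  by transfer (simp add: vec_eq_iff axis_def)

interpretation complex_octonion: vector_space "(*\<^sub>O) :: complex \<Rightarrow> complex octonion \<Rightarrow> _"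
  by (rule vector_space_octonion)

theorem theorem3p7:
  fixes r s t :: real
    and V\<^sub>0 V\<^sub>1 V\<^sub>2 :: int
    and V :: "nat \<Rightarrow> real"
    and \<alpha> \<omega>\<^sub>1 \<omega>\<^sub>2 P Q R :: complex
    and n :: nat
  assumes "tribonacci_delta r s t > 0"
    and "V = gen_tribonacci r s t V\<^sub>0 V\<^sub>1 V\<^sub>2"
    and "{x :: complex. x^3 - of_real r * x^2 - of_real s * x - of_real t = 0} = {\<alpha>, \<omega>\<^sub>1, \<omega>\<^sub>2}"
    and "\<alpha> \<in> \<real>"
    and "P = of_real (V 2) - (\<omega>\<^sub>1 + \<omega>\<^sub>2) * of_real (V 1) + \<omega>\<^sub>1 * \<omega>\<^sub>2 * of_real (V 0)"
    and "Q = of_real (V 2) - (\<alpha> + \<omega>\<^sub>2) * of_real (V 1) + \<alpha> * \<omega>\<^sub>2 * of_real (V 0)"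
    and "R = of_real (V 2) - (\<alpha> + \<omega>\<^sub>1) * of_real (V 1) + \<alpha> * \<omega>\<^sub>1 * of_real (V 0)"
  shows "octonion_complexify (tribonacci_octonion V n) =
      (P * \<alpha>^n / ((\<alpha> - \<omega>\<^sub>1) * (\<alpha> - \<omega>\<^sub>2))) *\<^sub>O octonion_powers \<alpha>
    - (Q * \<omega>\<^sub>1^n / ((\<alpha> - \<omega>\<^sub>1) * (\<omega>\<^sub>1 - \<omega>\<^sub>2))) *\<^sub>O octonion_powers \<omega>\<^sub>1
    + (R * \<omega>\<^sub>2^n / ((\<alpha> - \<omega>\<^sub>2) * (\<omega>\<^sub>1 - \<omega>\<^sub>2))) *\<^sub>O octonion_powers \<omega>\<^sub>2"
proof -
  have distinct: "\<alpha> \<noteq> \<omega>\<^sub>1" "\<alpha> \<noteq> \<omega>\<^sub>2" "\<omega>\<^sub>1 \<noteq> \<omega>\<^sub>2"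
    using distinct_cubic_roots[OF _ assms(3)] assms(1) by auto
  have roots: "\<alpha>^3 - of_real r * \<alpha>^2 - of_real s * \<alpha> - of_real t = 0"
      "\<omega>\<^sub>1^3 - of_real r * \<omega>\<^sub>1^2 - of_real s * \<omega>\<^sub>1 - of_real t = 0"
      "\<omega>\<^sub>2^3 - of_real r * \<omega>\<^sub>2^2 - of_real s * \<omega>\<^sub>2 - of_real t = 0"
    using assms(3) by blast+
  have rec: "complex_of_real (V (m + 3))
      = of_real r * of_real (V (m + 2)) + of_real s * of_real (V (m + 1)) + of_real t * of_real (V m)"
    for m
    unfolding assms(2) gen_tribonacci_rec by simp
  define A where "A = P * \<alpha>^n / ((\<alpha> - \<omega>\<^sub>1) * (\<alpha> - \<omega>\<^sub>2))"
  define B where "B = Q * \<omega>\<^sub>1^n / ((\<alpha> - \<omega>\<^sub>1) * (\<omega>\<^sub>1 - \<omega>\<^sub>2))"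
  define C where "C = R * \<omega>\<^sub>2^n / ((\<alpha> - \<omega>\<^sub>2) * (\<omega>\<^sub>1 - \<omega>\<^sub>2))"
  have coeff: "complex_of_real (V (n + l)) = A * \<alpha>^l - B * \<omega>\<^sub>1^l + C * \<omega>\<^sub>2^l" for l
    using binet_third_order[of "\<lambda>m. complex_of_real (V m)", OF rec roots distinct, of "n + l"]
    unfolding A_def B_def C_def assms(5-7) by (simp only: power_add times_divide_eq_left mult.assoc)
  have "octonion_complexify (tribonacci_octonion V n) = (\<Sum>l=0..7. of_real (V (n + l)) *\<^sub>O \<e> l)"
    by (simp add: tribonacci_octonion_def octonion_complexify_sum octonion_complexify_scale_basis)
  also have "\<dots> = A *\<^sub>O octonion_powers \<alpha> - B *\<^sub>O octonion_powers \<omega>\<^sub>1 + C *\<^sub>O octonion_powers \<omega>\<^sub>2"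
    unfolding coeff octonion_powers_def
    by (simp only: complex_octonion.scale_left_distrib complex_octonion.scale_left_diff_distrib
        sum.distrib sum_subtractf complex_octonion.scale_sum_right complex_octonion.scale_scale)
  finally show ?thesis
    unfolding A_def B_def C_def .
qed

end
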